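(* Let $p\in\mathbb{N}$ (a positive integer), $p-1<\alpha<p$, and let $D_t^\alpha={}^{\mathrm{RL}}D_t^\alpha$ be the Riemann-Liouville derivative. Consider the PDE $D_t^\alpha u-D_x^2K(u)=0$ and the numerical method $$D_{\Delta t}^\alpha u_{i,j}-D_{\Delta x}^{(2)}K(u_{i,j})=0 .$$ (i) For every $p$, solutions of the method satisfy the two discrete conservation laws $$D_{\Delta x}\widetilde F_\ell(x_i,t_j,u_{i,j})+D_{\Delta t}\widetilde G_\ell(x_i,t_j,u_{i,j})=0,\qquad \ell=1,2,$$ with $$\widetilde F_1(x_i,t_j,u_{i,j})=-D_{\Delta x}K(u_{i-1,j}),\qquad \widetilde G_1(x_i,t_j,u_{i,j})=\sum_{r=0}^{j-1}\Delta t_r\,D_{\Delta t}^\alpha u_{i,r},$$ $$\widetilde F_2(x_i,t_j,u_{i,j})=\tfrac1{\Delta x}\big(x_iK(u_{i-1,j})-x_{i-1}K(u_{i,j})\big)=A_{\Delta x}K(u_{i-1,j})-A_{\Delta x}(x_{i-1})\,D_{\Delta x}K(u_{i-1,j}),\qquad \widetilde G_2=x_i\widetilde G_1 .$$ They approximate, with the same accuracy as the method, the continuous conservation laws $D_xF_\ell+D_tG_\ell=0$ of the PDE with $$F_1=-D_xK(u),\quad G_1=D_t^{p-1}I_t^{p-\alpha}u,\qquad F_2=K(u)-xD_xK(u),\quad G_2=xG_1 .$$ (ii) If $p=2$ (i.e. $1<\alpha<2$), solutions of the method satisfy in addition the discrete conservation laws $D_{\Delta x}\widetilde F_\ell+D_{\Delta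 t}\widetilde G_\ell=0$, $\ell=3,4$, with $$\widetilde F_3=t_j\widetilde F_1=-t_jD_{\Delta x}K(u_{i-1,j}),\qquad \widetilde G_3(x_i,t_j,u_{i,j})=t_j\widetilde G_1(x_i,t_j,u_{i,j})-\sum_{r=1}^{j}\Delta t_{r-1}\,\widetilde G_1(x_i,t_r,u_{i,r}),$$ $$\widetilde F_4=t_j\widetilde F_2,\qquad \widetilde G_4=x_i\widetilde G_3 .$$ They approximate, with the same accuracy as the method, the continuous conservation laws $D_xF_\ell+D_tG_\ell=0$ with $$F_3=-tD_xK(u),\quad G_3=tD_t^{\alpha-1}u-I_t^{2-\alpha}u,\qquad F_4=tK(u)-xtD_xK(u),\quad G_4=xtD_t^{\alpha-1}u-xI_t^{2-\alpha}u .$$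
   Context: PDE: $u=u(x,t)$, $(x,t)\in(a,b)\times(t_0,T)$. Riemann-Liouville derivative: ${}^{\mathrm{RL}}D_t^\alpha f=D_t^p(I_t^{p-\alpha}f)$ with $I_t^{p-\alpha}f=\frac1{\Gamma(p-\alpha)}\int_{t_0}^t\frac{f(x,\tau)}{(t-\tau)^{1-p+\alpha}}d\tau$; for $p=2$, $D_t^{\alpha-1}u=D_tI_t^{2-\alpha}u$. Grid: $x_i=a+i\Delta x$, $i=0,\ldots,M+1$, $\Delta x=(b-a)/(M+1)$; $t_0<t_1<\dots<t_N=T$, $t_{j+1}=t_j+\Delta t_j$ (not necessarily uniform). $u_{i,j}$ denotes the approximation of $u(x_i,t_j)$ and $D_{\Delta t}^\alpha u_{i,j}$ the approximation of $D_t^\alpha u(x_i,t_j)$ produced by the time integrator. Empty sums are zero. Operators: $D_{\Delta x}f_{i,j}=(f_{i+1,j}-f_{i,j})/\Delta x$, $D_{\Delta t}f_{i,j}=(f_{i,j+1}-f_{i,j})/\Delta t_j$, $A_{\Delta x}f_{i,j}=(f_{i+1,j}+f_{i,j})/2$, $D^{(2)}_{\Delta x}f_{i,j}=(f_{i+1,j}-2f_{i,j}+f_{i-1,j})/\Delta x^2$. Identities are understood at $i=1,\ldots,M$, $j=0,\ldots,N-1$. "Same accuracy as the method" means that, with $(k,\rho)=(0,1),(1,1),(0,t),(1,t)$ for $\ell=1,2,3,4$ respectively, the discrete divergence and the continuous one correspond to the scheme residual multiplied by $x_i^k\rho(t_j)$ and to $x^k\rho(t)(D_t^\alpha u-D_x^2K(u))$,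 respectively, and that, for smooth $u$ sampled on the grid, their difference at $(x_i,t_j)$ has the same order as the difference between $D_{\Delta t}^\alpha u_{i,j}-D_{\Delta x}^{(2)}K(u_{i,j})$ and $D_t^\alpha u-D_x^2K(u)$. *)

theory Defs
  imports "HOL-Analysis.Analysis" "HOL-Library.Landau_Symbols"
begin

section \<open>Grids and discrete operators\<close>

text \<open>Only the nodes \<open>x_node g i\<close> with \<open>i \<le> n_x g + 1\<close> and \<open>t_node g j\<close> with \<open>j \<le> n_t g\<close>
  belong to the grid; mesh functions are total, and their values at other indices are irrelevant.\<close>

record grid =
  x_left :: real
  x_right :: real
  n_x :: nat
  n_t :: nat
  t_node :: "nat \<Rightarrow> real"

type_synonym mesh = "nat \<Rightarrow> nat \<Rightarrow> real"
type_synonym field = "real \<Rightarrow> real \<Rightarrow> real"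

definition grid_on :: "real \<Rightarrow> real \<Rightarrow> real \<Rightarrow> real \<Rightarrow> grid \<Rightarrow> bool" where
  "grid_on a b t0 T g \<longleftrightarrow>
     x_left g = a \<and> x_right g = b \<and> 0 < n_t g \<and> t_node g 0 = t0 \<and> t_node g (n_t g) = T \<and>
     (\<forall>j<n_t g. t_node g j < t_node g (j + 1))"

definition dx :: "grid \<Rightarrow> real" where
  "dx g = (x_right g - x_left g) / (real (n_x g) + 1)"

definition x_node :: "grid \<Rightarrow> nat \<Rightarrow> real" where
  "x_node g i = x_left g + real i * dx g"

definition dt :: "grid \<Rightarrow> nat \<Rightarrow> real" where
  "dt g j = t_node g (j + 1) - t_node g j"

definition D_dx :: "grid \<Rightarrow> mesh \<Rightarrow> mesh" where
  "D_dx g f i j = (f (i + 1) j - f i j) / dx g"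

definition D_dt :: "grid \<Rightarrow> mesh \<Rightarrow> mesh" where
  "D_dt g f i j = (f i (j + 1) - f i j) / dt g j"

definition A_dx :: "mesh \<Rightarrow> mesh" where
  "A_dx f i j = (f (i + 1) j + f i j) / 2"

text \<open>Indices are natural numbers, so expressions with \<open>i - 1\<close> are only meaningful for \<open>i \<ge> 1\<close>.\<close>

definition D2_dx :: "grid \<Rightarrow> mesh \<Rightarrow> mesh" where
  "D2_dx g f i j = (f (i + 1) j - 2 * f i j + f (i - 1) j) / (dx g)\<^sup>2"

definition Kmesh :: "(real \<Rightarrow> real) \<Rightarrow> mesh \<Rightarrow> mesh" where
  "Kmesh K u i j = K (u i j)"

definition sample :: "grid \<Rightarrow> field \<Rightarrow> mesh" where
  "sample g u i j = u (x_node g i) (t_node g j)"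


section \<open>The method and its discrete conservation laws\<close>

text \<open>A time integrator assigns to a grid and a mesh function \<open>u\<close> the mesh function of the
  approximations of the fractional time derivative of \<open>u\<close> at the nodes. It is left arbitrary:
  it may depend on all the mesh values, and no consistency is required.\<close>

type_synonym integrator = "grid \<Rightarrow> mesh \<Rightarrow> mesh"

definition scheme_residual :: "(real \<Rightarrow> real) \<Rightarrow> integrator \<Rightarrow> grid \<Rightarrow> mesh \<Rightarrow> mesh" where
  "scheme_residual K \<D> g u i j = \<D> g u i j - D2_dx g (Kmesh K u) i j"

definition method_solution :: "(real \<Rightarrow> real) \<Rightarrow> integrator \<Rightarrow> grid \<Rightarrow> mesh \<Rightarrow> bool" where
  "method_solution K \<D> g u \<longleftrightarrow>
     (\<forall>i\<in>{1..n_x g}. \<forall>j<n_t g. scheme_residual K \<D> g u i j = 0)"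

definition disc_div :: "grid \<Rightarrow> mesh \<Rightarrow> mesh \<Rightarrow> mesh" where
  "disc_div g F G i j = D_dx g F i j + D_dt g G i j"

definition disc_conservation_law :: "grid \<Rightarrow> mesh \<Rightarrow> mesh \<Rightarrow> bool" where
  "disc_conservation_law g F G \<longleftrightarrow> (\<forall>i\<in>{1..n_x g}. \<forall>j<n_t g. disc_div g F G i j = 0)"

definition dF1 :: "(real \<Rightarrow> real) \<Rightarrow> grid \<Rightarrow> mesh \<Rightarrow> mesh" where
  "dF1 K g u i j = - D_dx g (Kmesh K u) (i - 1) j"

definition dG1 :: "integrator \<Rightarrow> grid \<Rightarrow> mesh \<Rightarrow> mesh" where
  "dG1 \<D> g u i j = (\<Sum>r<j. dt g r * \<D> g u i r)"

definition dF2 :: "(real \<Rightarrow> real) \<Rightarrow> grid \<Rightarrow> mesh \<Rightarrow> mesh" where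
  "dF2 K g u i j = 1 / dx g * (x_node g i * K (u (i - 1) j) - x_node g (i - 1) * K (u i j))"

definition dG2 :: "integrator \<Rightarrow> grid \<Rightarrow> mesh \<Rightarrow> mesh" where
  "dG2 \<D> g u i j = x_node g i * dG1 \<D> g u i j"

definition dF3 :: "(real \<Rightarrow> real) \<Rightarrow> grid \<Rightarrow> mesh \<Rightarrow> mesh" where
  "dF3 K g u i j = t_node g j * dF1 K g u i j"

definition dG3 :: "integrator \<Rightarrow> grid \<Rightarrow> mesh \<Rightarrow> mesh" where
  "dG3 \<D> g u i j = t_node g j * dG1 \<D> g u i j - (\<Sum>r=1..j. dt g (r - 1) * dG1 \<D> g u i r)"

definition dF4 :: "(real \<Rightarrow> real) \<Rightarrow> grid \<Rightarrow> mesh \<Rightarrow> mesh" where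
  "dF4 K g u i j = t_node g j * dF2 K g u i j"

definition dG4 :: "integrator \<Rightarrow> grid \<Rightarrow> mesh \<Rightarrow> mesh" where
  "dG4 \<D> g u i j = x_node g i * dG3 \<D> g u i j"


section \<open>The fractional PDE and its conservation laws\<close>

text \<open>For \<open>t < t0\<close> the interval of integration is empty, so \<open>RL_int\<close> is extended by zero to the
  left of \<open>t0\<close>.\<close>

definition RL_int :: "real \<Rightarrow> real \<Rightarrow> (real \<Rightarrow> real) \<Rightarrow> real \<Rightarrow> real" where
  "RL_int t0 \<beta> f t = 1 / Gamma \<beta> * (LINT \<tau>:{t0..t}|lborel. f \<tau> / (t - \<tau>) powr (1 - \<beta>))"

text \<open>Riemann-Liouville derivative of order \<open>\<alpha>\<close>, where \<open>p - 1 < \<alpha> < p\<close>.\<close>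

definition RL_deriv :: "real \<Rightarrow> nat \<Rightarrow> real \<Rightarrow> (real \<Rightarrow> real) \<Rightarrow> real \<Rightarrow> real" where
  "RL_deriv t0 p \<alpha> f = (deriv ^^ p) (RL_int t0 (real p - \<alpha>) f)"

definition times_differentiable_near :: "nat \<Rightarrow> (real \<Rightarrow> real) \<Rightarrow> real \<Rightarrow> bool" where
  "times_differentiable_near n f x \<longleftrightarrow>
     (\<forall>m<n. \<forall>\<^sub>F y in nhds x. (deriv ^^ m) f field_differentiable (at y))"

text \<open>All the expressions in the PDE make sense at and near \<open>(x, t)\<close>. This is needed because
  \<open>deriv\<close> and the integral are total functions. At \<open>t = t0\<close> it holds only for special \<open>u\<close>: for
  continuous \<open>u\<close> with \<open>u x t0 \<noteq> 0\<close> the fractional derivative does not exist there.\<close>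

definition regular_at ::
  "real \<Rightarrow> nat \<Rightarrow> real \<Rightarrow> (real \<Rightarrow> real) \<Rightarrow> field \<Rightarrow> real \<Rightarrow> real \<Rightarrow> bool" where
  "regular_at t0 p \<alpha> K u x t \<longleftrightarrow>
     times_differentiable_near 2 (\<lambda>y. K (u y t)) x \<and>
     (\<forall>\<^sub>F s in nhds t.
        set_integrable lborel {t0..s} (\<lambda>\<tau>. u x \<tau> / (s - \<tau>) powr (1 - (real p - \<alpha>)))) \<and>
     times_differentiable_near p (RL_int t0 (real p - \<alpha>) (u x)) t"

definition pde_residual ::
  "real \<Rightarrow> nat \<Rightarrow> real \<Rightarrow> (real \<Rightarrow> real) \<Rightarrow> field \<Rightarrow> field" where
  "pde_residual t0 p \<alpha> K u x t = RL_deriv t0 p \<alpha> (u x) t - (deriv ^^ 2) (\<lambda>y. K (u y t)) x"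

definition pde_solution ::
  "real \<Rightarrow> real \<Rightarrow> real \<Rightarrow> real \<Rightarrow> nat \<Rightarrow> real \<Rightarrow> (real \<Rightarrow> real) \<Rightarrow> field \<Rightarrow> bool" where
  "pde_solution a b t0 T p \<alpha> K u \<longleftrightarrow>
     (\<forall>x\<in>{a<..<b}. \<forall>t\<in>{t0<..<T}. regular_at t0 p \<alpha> K u x t \<and> pde_residual t0 p \<alpha> K u x t = 0)"

definition div_exists_at :: "field \<Rightarrow> field \<Rightarrow> real \<Rightarrow> real \<Rightarrow> bool" where
  "div_exists_at F G x t \<longleftrightarrow>
     (\<lambda>y. F y t) field_differentiable (at x) \<and> (\<lambda>s. G x s) field_differentiable (at t)"

definition cont_div :: "field \<Rightarrow> field \<Rightarrow> field" where
  "cont_div F G x t = deriv (\<lambda>y. F y t) x + deriv (\<lambda>s. G x s) t"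

definition conservation_law ::
  "real \<Rightarrow> real \<Rightarrow> real \<Rightarrow> real \<Rightarrow> field \<Rightarrow> field \<Rightarrow> bool" where
  "conservation_law a b t0 T F G \<longleftrightarrow>
     (\<forall>x\<in>{a<..<b}. \<forall>t\<in>{t0<..<T}. div_exists_at F G x t \<and> cont_div F G x t = 0)"

definition F1 :: "(real \<Rightarrow> real) \<Rightarrow> field \<Rightarrow> field" where
  "F1 K u x t = - deriv (\<lambda>y. K (u y t)) x"

definition G1 :: "real \<Rightarrow> nat \<Rightarrow> real \<Rightarrow> field \<Rightarrow> field" where
  "G1 t0 p \<alpha> u x t = (deriv ^^ (p - 1)) (RL_int t0 (real p - \<alpha>) (u x)) t"

definition F2 :: "(real \<Rightarrow> real) \<Rightarrow> field \<Rightarrow> field" where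
  "F2 K u x t = K (u x t) - x * deriv (\<lambda>y. K (u y t)) x"

definition G2 :: "real \<Rightarrow> nat \<Rightarrow> real \<Rightarrow> field \<Rightarrow> field" where
  "G2 t0 p \<alpha> u x t = x * G1 t0 p \<alpha> u x t"

text \<open>The remaining laws are for \<open>1 < \<alpha> < 2\<close>, so the derivative of order \<open>\<alpha> - 1\<close> is the
  Riemann-Liouville derivative with \<open>p = 1\<close>.\<close>

definition F3 :: "(real \<Rightarrow> real) \<Rightarrow> field \<Rightarrow> field" where
  "F3 K u x t = - t * deriv (\<lambda>y. K (u y t)) x"

definition G3 :: "real \<Rightarrow> real \<Rightarrow> field \<Rightarrow> field" where
  "G3 t0 \<alpha> u x t = t * RL_deriv t0 1 (\<alpha> - 1) (u x) t - RL_int t0 (2 - \<alpha>) (u x) t"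

definition F4 :: "(real \<Rightarrow> real) \<Rightarrow> field \<Rightarrow> field" where
  "F4 K u x t = t * K (u x t) - x * t * deriv (\<lambda>y. K (u y t)) x"

definition G4 :: "real \<Rightarrow> real \<Rightarrow> field \<Rightarrow> field" where
  "G4 t0 \<alpha> u x t = x * t * RL_deriv t0 1 (\<alpha> - 1) (u x) t - x * RL_int t0 (2 - \<alpha>) (u x) t"


section \<open>Accuracy\<close>

text \<open>\<open>u\<close> is smooth up to the boundary of the rectangle; \<open>v m n\<close> is its partial derivative of
  order \<open>m\<close> in \<open>x\<close> and \<open>n\<close> in \<open>t\<close>.\<close>

definition smooth_field :: "real \<Rightarrow> real \<Rightarrow> real \<Rightarrow> real \<Rightarrow> field \<Rightarrow> bool" where
  "smooth_field a b t0 T u \<longleftrightarrow>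
     (\<exists>v :: nat \<Rightarrow> nat \<Rightarrow> field.
        (\<forall>x\<in>{a..b}. \<forall>t\<in>{t0..T}. v 0 0 x t = u x t) \<and>
        (\<forall>m n. continuous_on ({a..b} \<times> {t0..T}) (\<lambda>(x, t). v m n x t) \<and>
          (\<forall>x\<in>{a..b}. \<forall>t\<in>{t0..T}.
             ((\<lambda>y. v m n y t) has_real_derivative v (Suc m) n x t) (at x within {a..b}) \<and>
             ((\<lambda>s. v m n x s) has_real_derivative v m (Suc n) x t) (at t within {t0..T}))))"

definition smooth_data :: "real \<Rightarrow> real \<Rightarrow> real \<Rightarrow> real \<Rightarrow> (real \<Rightarrow> real) \<Rightarrow> field \<Rightarrow> bool" where
  "smooth_data a b t0 T K u \<longleftrightarrow>
     smooth_field a b t0 T u \<and>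
     (\<exists>S. open S \<and> (\<forall>x\<in>{a..b}. \<forall>t\<in>{t0..T}. u x t \<in> S) \<and>
          (\<forall>n. \<forall>y\<in>S. (deriv ^^ n) K field_differentiable (at y)))"

definition method_error ::
  "real \<Rightarrow> nat \<Rightarrow> real \<Rightarrow> (real \<Rightarrow> real) \<Rightarrow> integrator \<Rightarrow> field \<Rightarrow> grid \<Rightarrow> mesh" where
  "method_error t0 p \<alpha> K \<D> u g i j =
     scheme_residual K \<D> g (sample g u) i j - pde_residual t0 p \<alpha> K u (x_node g i) (t_node g j)"

definition law_error ::
  "(grid \<Rightarrow> mesh \<Rightarrow> mesh) \<Rightarrow> (grid \<Rightarrow> mesh \<Rightarrow> mesh) \<Rightarrow> (field \<Rightarrow> field) \<Rightarrow> (field \<Rightarrow> field)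
     \<Rightarrow> field \<Rightarrow> grid \<Rightarrow> mesh" where
  "law_error dF dG F G u g i j =
     disc_div g (dF g (sample g u)) (dG g (sample g u)) i j
     - cont_div (F u) (G u) (x_node g i) (t_node g j)"

text \<open>The discrete law given by \<open>dF\<close>, \<open>dG\<close> approximates the law given by \<open>F\<close>, \<open>G\<close> with the same
  accuracy as the method, the multiplier being \<open>x ^ k * \<rho> t\<close>. The first two conditions concern
  arbitrary \<open>u\<close>, not only solutions. In the third, the order of an error is its asymptotic
  behaviour along an arbitrary sequence of grids and of nodes of these grids: the error of the law
  is bounded by a multiple of that of the method, and both are of exactly the same order if the
  multiplier stays away from zero at the chosen nodes. The initial time level \<open>j = 0\<close> is included
  only if the fractional derivative of \<open>u\<close> exists there.\<close>

definition same_accuracy ::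
  "real \<Rightarrow> real \<Rightarrow> real \<Rightarrow> real \<Rightarrow> nat \<Rightarrow> real \<Rightarrow> (real \<Rightarrow> real) \<Rightarrow> integrator \<Rightarrow> nat \<Rightarrow> (real \<Rightarrow> real)
     \<Rightarrow> (grid \<Rightarrow> mesh \<Rightarrow> mesh) \<Rightarrow> (grid \<Rightarrow> mesh \<Rightarrow> mesh) \<Rightarrow> (field \<Rightarrow> field) \<Rightarrow> (field \<Rightarrow> field)
     \<Rightarrow> bool" where
  "same_accuracy a b t0 T p \<alpha> K \<D> k \<rho> dF dG F G \<longleftrightarrow>
     (\<forall>g u. \<forall>i\<in>{1..n_x g}. \<forall>j<n_t g. grid_on a b t0 T g \<longrightarrow>
        disc_div g (dF g u) (dG g u) i j =
          x_node g i ^ k * \<rho> (t_node g j) * scheme_residual K \<D> g u i j) \<and>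
     (\<forall>u. \<forall>x\<in>{a<..<b}. \<forall>t\<in>{t0..<T}. regular_at t0 p \<alpha> K u x t \<longrightarrow>
        div_exists_at (F u) (G u) x t \<and>
        cont_div (F u) (G u) x t = x ^ k * \<rho> t * pde_residual t0 p \<alpha> K u x t) \<and>
     (\<forall>u (g :: nat \<Rightarrow> grid) i j.
        smooth_data a b t0 T K u \<and>
        (\<forall>n. grid_on a b t0 T (g n) \<and> i n \<in> {1..n_x (g n)} \<and> j n < n_t (g n) \<and>
             (j n \<ge> 1 \<or> regular_at t0 p \<alpha> K u (x_node (g n) (i n)) t0)) \<longrightarrow>
        (\<lambda>n. law_error dF dG F G u (g n) (i n) (j n))
          \<in> O(\<lambda>n. method_error t0 p \<alpha> K \<D> u (g n) (i n) (j n)) \<and>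
        ((\<exists>c>0. \<forall>n. c \<le> \<bar>x_node (g n) (i n) ^ k * \<rho> (t_node (g n) (j n))\<bar>) \<longrightarrow>
          (\<lambda>n. law_error dF dG F G u (g n) (i n) (j n))
            \<in> \<Theta>(\<lambda>n. method_error t0 p \<alpha> K \<D> u (g n) (i n) (j n))))"

end

(* Discretely, the difference operators applied to the fluxes and densities telescope to the scheme
   residual times x_i^k rho(t_j); the same product rule holds for the continuous laws. Hence the error
   of each law is the multiplier times the error of the method, and the multiplier is bounded on the
   rectangle. The analytic input is that for smooth data the continuous laws make sense at t > t0:
   Riemann-Liouville integrals of smooth functions are smooth on the open time interval. *)

theory Submission
  imports Defs
begin

text \<open>The Riemann-Liouville integral cannot be differentiated under the integral sign as it
  stands, since for 0 < \<beta> < 1 its kernel is singular at the moving endpoint \<tau> = t. Over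
  the fixed interval [0,1] it becomes (t - t0)^\<beta> times an integral in which t enters only
  through the smooth integrand. The power (t - t0)^\<beta> confines the argument to t > t0, so nodes
  with j = 0 rely on the regularity assumed there. On the discrete side the densities are built from
  the integrator's own values, so a time difference returns such a value whatever the integrator is.
  The weight t_j is absorbed by summation by parts, the weight x_i by x_(i+1) + x_(i-1) = 2
  x_i.\<close>

subsection \<open>Higher differentiability on open sets of reals\<close>

text \<open>An existential witness replaces \<open>deriv\<close>, so the closure rules can name
  derivatives explicitly, and values of the witness off \<open>S\<close> do not matter. The return
  to iterated \<open>deriv\<close> is \<open>ntimes_differentiable_imp_near\<close>.\<close>

primrec ntimes_differentiable :: "nat \<Rightarrow> real set \<Rightarrow> (real \<Rightarrow> real) \<Rightarrow> bool" where
  "ntimes_differentiable 0 S f \<longleftrightarrow> True"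
| "ntimes_differentiable (Suc n) S f \<longleftrightarrow>
     (\<exists>f'. (\<forall>x\<in>S. (f has_field_derivative f' x) (at x)) \<and> ntimes_differentiable n S f')"

lemma ntimes_differentiable_SucI:
  assumes "\<And>x. x \<in> S \<Longrightarrow> (f has_field_derivative f' x) (at x)" and "ntimes_differentiable n S f'"
  shows "ntimes_differentiable (Suc n) S f"
  using assms by auto

lemma ntimes_differentiable_Suc_imp:
  "ntimes_differentiable (Suc n) S f \<Longrightarrow> ntimes_differentiable n S f"
proof (induction n arbitrary: f)
  case (Suc n)
  then obtain f' where "\<forall>x\<in>S. (f has_field_derivative f' x) (at x)"
    "ntimes_differentiable (Suc n) S f'"
    by (metis ntimes_differentiable.simps(2))
  with Suc.IH[of f'] show ?case
    by auto
qed simp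

lemma ntimes_differentiable_cong:
  assumes "open S" and "ntimes_differentiable n S f" and "\<And>x. x \<in> S \<Longrightarrow> f x = g x"
  shows "ntimes_differentiable n S g"
proof (cases n)
  case (Suc k)
  with assms(2) obtain f' where f': "\<forall>x\<in>S. (f has_field_derivative f' x) (at x)"
    and "ntimes_differentiable k S f'"
    by auto
  moreover have "\<forall>x\<in>S. (g has_field_derivative f' x) (at x)"
    using has_field_derivative_transform_within_open[OF _ assms(1)] f' assms(3) by blast
  ultimately show ?thesis
    using Suc by auto
qed simp

lemma ntimes_differentiable_const: "ntimes_differentiable n S (\<lambda>x. c)"
  by (induction n arbitrary: c) (auto intro: DERIV_const)

lemma ntimes_differentiable_add:
  assumes "ntimes_differentiable n S f" and "ntimes_differentiable n S g"
  shows "ntimes_differentiable n S (\<lambda>x. f x + g x)"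
  using assms
proof (induction n arbitrary: f g)
  case (Suc n)
  from Suc.prems obtain f' g' where
    "\<forall>x\<in>S. (f has_field_derivative f' x) (at x)" "ntimes_differentiable n S f'"
    "\<forall>x\<in>S. (g has_field_derivative g' x) (at x)" "ntimes_differentiable n S g'"
    by auto
  then show ?case
    using Suc.IH by (intro ntimes_differentiable_SucI[where f' = "\<lambda>x. f' x + g' x"])
      (auto intro!: derivative_intros)
qed simp

lemma ntimes_differentiable_mult:
  assumes "ntimes_differentiable n S f" and "ntimes_differentiable n S g"
  shows "ntimes_differentiable n S (\<lambda>x. f x * g x)"
  using assms
proof (induction n arbitrary: f g)
  case (Suc n)
  from Suc.prems obtain f' g' where
    "\<forall>x\<in>S. (f has_field_derivative f' x) (at x)" "ntimes_differentiable n S f'"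
    "\<forall>x\<in>S. (g has_field_derivative g' x) (at x)" "ntimes_differentiable n S g'"
    by auto
  then show ?case
    \<comment> \<open>The derivative of the product still contains the undifferentiated factors,
      which therefore have to be weakened to order \<open>n\<close>.\<close>
    using Suc.IH Suc.prems[THEN ntimes_differentiable_Suc_imp]
    by (intro ntimes_differentiable_SucI[where f' = "\<lambda>x. f' x * g x + g' x * f x"]
        ntimes_differentiable_add) (auto intro!: DERIV_mult)
qed simp

lemma ntimes_differentiable_compose:
  assumes "ntimes_differentiable n T f" and "ntimes_differentiable n S g" and "g ` S \<subseteq> T"
  shows "ntimes_differentiable n S (\<lambda>x. f (g x))"
  using assms(1,2)
proof (induction n arbitrary: f)
  case (Suc n)
  from Suc.prems obtain f' g' where
    "\<forall>x\<in>T. (f has_field_derivative f' x) (at x)" "ntimes_differentiable n T f'"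
    "\<forall>x\<in>S. (g has_field_derivative g' x) (at x)" "ntimes_differentiable n S g'"
    by auto
  then show ?case
    using Suc.IH ntimes_differentiable_Suc_imp[OF Suc.prems(2)] assms(3)
    by (intro ntimes_differentiable_SucI[where f' = "\<lambda>x. f' (g x) * g' x"]
        ntimes_differentiable_mult) (auto intro!: DERIV_chain2[where f = f])
qed simp

lemma ntimes_differentiable_powr:
  "ntimes_differentiable n {c<..} (\<lambda>x. (x - c) powr r)"
proof (induction n arbitrary: r)
  case (Suc n)
  have "((\<lambda>x. (x - c) powr r) has_field_derivative r * (x - c) powr (r - 1)) (at x)"
    if "x \<in> {c<..}" for x
    using that by (auto intro!: derivative_eq_intros)
  then show ?case
    by (rule ntimes_differentiable_SucI)
      (auto intro!: ntimes_differentiable_mult ntimes_differentiable_const Suc.IH)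
qed simp

text \<open>Covers every chain of functions in which each is the derivative of the one before: the
  iterated derivatives of \<open>K\<close>, the partial derivatives of \<open>u\<close>, and the
  integrals \<open>H k\<close> below.\<close>

lemma ntimes_differentiable_family:
  assumes "\<And>k x. x \<in> S \<Longrightarrow> (f k has_field_derivative f (Suc k) x) (at x)"
  shows "ntimes_differentiable n S (f k)"
  by (induction n arbitrary: k) (use assms in auto)

lemma ntimes_differentiable_subset:
  "ntimes_differentiable n T f \<Longrightarrow> S \<subseteq> T \<Longrightarrow> ntimes_differentiable n S f"
proof (induction n arbitrary: f)
  case (Suc n)
  then obtain f' where "\<forall>x\<in>T. (f has_field_derivative f' x) (at x)"
    "ntimes_differentiable n T f'"
    by auto
  with Suc.IH[of f'] Suc.prems(2) show ?case
    by auto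
qed simp

lemma ntimes_differentiable_imp_near:
  assumes "open S" and "ntimes_differentiable n S f" and "x \<in> S"
  shows "times_differentiable_near n f x"
proof -
  have "(deriv ^^ m) f field_differentiable (at y)"
    if "m < n" "y \<in> S" "ntimes_differentiable n S f" for m y f
    using that
  proof (induction m arbitrary: f n)
    case 0
    then obtain k where "n = Suc k"
      by (cases n) auto
    with 0 show ?case
      by (auto simp: field_differentiable_def)
  next
    case (Suc m)
    then obtain k where k: "n = Suc k" "m < k"
      by (cases n) auto
    with Suc.prems(3) obtain f' where "\<forall>x\<in>S. (f has_field_derivative f' x) (at x)"
      and "ntimes_differentiable k S f'"
      by auto
    \<comment> \<open>\<open>deriv f\<close> agrees with the witness \<open>f'\<close> on
      \<open>S\<close>, and \<open>S\<close> is open; the induction then continues with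
      \<open>deriv f\<close>, the innermost derivative being peeled off.\<close>
    then have "ntimes_differentiable k S (deriv f)"
      by (metis DERIV_imp_deriv assms(1) ntimes_differentiable_cong)
    with Suc.IH[OF k(2) Suc.prems(2)] show ?case
      by (simp add: funpow_Suc_right del: funpow.simps)
  qed
  then show ?thesis
    unfolding times_differentiable_near_def using assms by (auto simp: eventually_nhds)
qed


subsection \<open>Riemann-Liouville integrals of smooth functions\<close>

text \<open>The substitution \<open>\<tau> = t - (t - t0) w powr (1/\<beta>)\<close> removes both the singularity of the kernel and
  the dependence of the domain of integration on \<open>t\<close>.\<close>

lemma RL_int_substitution:
  fixes f :: "real \<Rightarrow> real"
  assumes \<beta>: "0 < \<beta>" and t: "t0 < t" and f: "continuous_on {t0..t} f"
  shows "set_integrable lborel {t0..t} (\<lambda>\<tau>. f \<tau> / (t - \<tau>) powr (1 - \<beta>))" (is ?int)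
    and "RL_int t0 \<beta> f t =
           1 / (\<beta> * Gamma \<beta>) * (t - t0) powr \<beta>
             * integral {0..1} (\<lambda>w. f (t0 + (1 - w powr (1 / \<beta>)) * (t - t0)))" (is ?eq)
proof -
  define g where "g w = t0 + (1 - w powr (1 / \<beta>)) * (t - t0)" for w
  define g' where "g' w = - (t - t0) / \<beta> * w powr (1 / \<beta> - 1)" for w
  define h where "h \<tau> = f \<tau> / (t - \<tau>) powr (1 - \<beta>)" for \<tau>
  \<comment> \<open>What remains of Jacobian times kernel once the powers of w have
    cancelled.\<close>
  define c where "c = (t - t0) powr \<beta> / \<beta>"
  have w_powr_le1: "w powr (1 / \<beta>) \<le> 1" if "w \<in> {0..1}" for w
    using that \<beta> by (intro powr_le1) auto
  have cont_g: "continuous_on {0..1} g"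
    unfolding g_def using \<beta> by (intro continuous_intros continuous_on_powr') auto
  have g_mem: "g w \<in> {t0..t}" if "w \<in> {0..1}" for w
  proof -
    have "0 \<le> (1 - w powr (1 / \<beta>)) * (t - t0)" "(1 - w powr (1 / \<beta>)) * (t - t0) \<le> 1 * (t - t0)"
      using w_powr_le1[OF that] t by (auto intro!: mult_right_mono mult_nonneg_nonneg)
    then show ?thesis
      by (auto simp: g_def)
  qed
  have cont_fg: "continuous_on {0..1} (\<lambda>w. f (g w))"
    by (rule continuous_on_compose2[OF f cont_g]) (use g_mem in auto)
  \<comment> \<open>w = 0 is left out because for \<beta> > 1 the map \<open>g\<close> has no finite
    slope there. Its image \<tau> = t drops out as well; both points are restored at the end as null
    sets.\<close>
  have deriv_g: "(g has_field_derivative g' w) (at w within {0<..1})" if "w \<in> {0<..1}" for w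
  proof -
    have "(g has_field_derivative (- (1 / \<beta> * w powr (1 / \<beta> - 1))) * (t - t0)) (at w within {0<..1})"
      unfolding g_def using that by (auto intro!: derivative_eq_intros)
    then show ?thesis
      by (rule DERIV_cong) (use \<beta> in \<open>simp add: g'_def field_simps\<close>)
  qed
  have inj_g: "inj_on g {0<..1}"
  proof (rule inj_onI)
    fix v w assume "v \<in> {0<..1}" "w \<in> {0<..1}" "g v = g w"
    with t have "v powr (1 / \<beta>) = w powr (1 / \<beta>)"
      by (auto simp: g_def)
    then have "(v powr (1 / \<beta>)) powr \<beta> = (w powr (1 / \<beta>)) powr \<beta>"
      by simp
    with \<open>v \<in> _\<close> \<open>w \<in> _\<close> \<beta> show "v = w"
      by (simp add: powr_powr)
  qed
  have image_g: "g ` {0<..1} = {t0..<t}"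
  proof (intro equalityI subsetI)
    fix s assume "s \<in> g ` {0<..1}"
    then obtain w where w: "w \<in> {0<..1}" "s = g w"
      by auto
    moreover have "0 < w powr (1 / \<beta>) * (t - t0)"
      using w t by (intro mult_pos_pos) auto
    then have "g w < t"
      by (simp add: g_def algebra_simps)
    ultimately show "s \<in> {t0..<t}"
      using g_mem[of w] by auto
  next
    fix s assume s: "s \<in> {t0..<t}"
    \<comment> \<open>Obtained by solving \<open>g w = s\<close> for \<open>w\<close>.\<close>
    define w where "w = ((t - s) / (t - t0)) powr \<beta>"
    have "0 < (t - s) / (t - t0)" "(t - s) / (t - t0) \<le> 1"
      using s t by (auto simp: field_simps)
    then have "w \<in> {0<..1}" "w powr (1 / \<beta>) = (t - s) / (t - t0)"
      using \<beta> s t by (auto simp: w_def powr_powr intro!: powr_le1)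
    then show "s \<in> g ` {0<..1}"
      using t by (intro image_eqI[where x = w]) (auto simp: g_def field_simps)
  qed
  \<comment> \<open>This dictates the exponent 1/\<beta>: since (1/\<beta>)(1 - \<beta>) = 1/\<beta>
    - 1, the kernel contributes in the denominator exactly the power of w that the Jacobian
    has.\<close>
  have integrand: "\<bar>g' w\<bar> * h (g w) = c * f (g w)" if "w \<in> {0<..1}" for w
  proof -
    have w: "0 < w"
      using that by simp
    have "t - g w = (t - t0) * w powr (1 / \<beta>)" "1 / \<beta> * (1 - \<beta>) = 1 / \<beta> - 1"
      using \<beta> by (simp_all add: g_def algebra_simps diff_divide_distrib)
    then have "(t - g w) powr (1 - \<beta>) = (t - t0) powr (1 - \<beta>) * w powr (1 / \<beta> - 1)"
      using t by (simp only: powr_mult powr_powr)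
    moreover have "\<bar>g' w\<bar> = (t - t0) / \<beta> * w powr (1 / \<beta> - 1)"
      using t \<beta> by (simp add: g'_def abs_mult)
    moreover have "(t - t0) / (t - t0) powr (1 - \<beta>) = (t - t0) powr \<beta>"
      using t by (simp add: powr_diff)
    moreover have "w powr (1 / \<beta> - 1) \<noteq> 0"
      using w by simp
    moreover have "x / \<beta> * P * (y / (Q * P)) = x / Q / \<beta> * y" if "P \<noteq> 0" for x y P Q :: real
      using that by (simp add: divide_simps)
    ultimately show ?thesis
      unfolding h_def c_def by (simp only: not_False_eq_True)
  qed
  have spike: "negligible {x \<in> A - B. k x \<noteq> 0}" if "A - B \<subseteq> {z}"
    for A B :: "real set" and z and k :: "real \<Rightarrow> real"
    by (rule negligible_subset[of "{z}"]) (use that in auto)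
  have diff1: "{0<..1::real} - {0..1} \<subseteq> {0}" "{0..1::real} - {0<..1} \<subseteq> {0}"
    and diff2: "{t0..<t} - {t0..t} \<subseteq> {t}" "{t0..t} - {t0..<t} \<subseteq> {t}"
    by auto
  have "(\<lambda>w. c * f (g w)) absolutely_integrable_on {0..1}"
    by (intro absolutely_integrable_continuous_real continuous_intros cont_fg)
  then have "(\<lambda>w. c * f (g w)) absolutely_integrable_on {0<..1}"
    by (rule set_integrable_subset) auto
  then have "(\<lambda>w. \<bar>g' w\<bar> * h (g w)) absolutely_integrable_on {0<..1}"
    by (subst set_integrable_cong[OF refl refl integrand]) auto
  then have h: "h absolutely_integrable_on {t0..<t}"
    and int_h: "integral {t0..<t} h = integral {0<..1} (\<lambda>w. \<bar>g' w\<bar> * h (g w))"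
    using has_absolute_integral_change_of_variables_1'[OF _ deriv_g inj_g, of h
        "integral {0<..1} (\<lambda>w. \<bar>g' w\<bar> * h (g w))"] image_g by auto
  have h': "h absolutely_integrable_on {t0..t}"
    using h absolutely_integrable_spike_set_eq[OF spike[OF diff2(1)] spike[OF diff2(2)]] by blast
  \<comment> \<open>The change of variables yields integrability for the completed measure; Borel
    measurability brings it down to \<open>lborel\<close>, over which \<open>RL_int\<close> is
    defined.\<close>
  have "(\<lambda>\<tau>. indicator {t0..t} \<tau> *\<^sub>R f \<tau>) \<in> borel_measurable borel"
    by (intro borel_measurable_continuous_on_indicator f) auto
  then have "(\<lambda>\<tau>. indicator {t0..t} \<tau> *\<^sub>R f \<tau> / (t - \<tau>) powr (1 - \<beta>)) \<in> borel_measurable borel"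
    by measurable
  then have meas: "(\<lambda>\<tau>. indicator {t0..t} \<tau> *\<^sub>R h \<tau>) \<in> borel_measurable lborel"
    by (simp add: h_def)
  show int: ?int
    using h' integrable_completion[OF meas] by (simp add: set_integrable_def h_def)
  have "(LINT \<tau>:{t0..t}|lborel. h \<tau>) = integral {t0..t} h"
    using int unfolding h_def by (rule set_borel_integral_eq_integral(2))
  also have "\<dots> = integral {t0..<t} h"
    by (rule integral_spike_set[OF spike[OF diff2(2)] spike[OF diff2(1)]])
  also have "\<dots> = integral {0<..1} (\<lambda>w. c * f (g w))"
    unfolding int_h by (intro integral_cong integrand)
  also have "\<dots> = integral {0..1} (\<lambda>w. c * f (g w))"
    by (rule integral_spike_set[OF spike[OF diff1(1)] spike[OF diff1(2)]])
  also have "\<dots> = c * integral {0..1} (\<lambda>w. f (g w))"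
    by simp
  finally show ?eq
    by (simp add: RL_int_def h_def g_def c_def)
qed

text \<open>Leibniz rule on a fixed interval. As \<theta> takes values in [0,1], the argument of
  \<open>f\<close> stays between t0 and t. Each differentiation brings out one more factor \<theta>;
  the free weight \<open>m\<close> collects these, so that the rule can be iterated.\<close>

lemma has_field_derivative_integral_rescaled:
  fixes f \<theta> m :: "real \<Rightarrow> real"
  assumes f: "\<And>s. s \<in> {t0..T} \<Longrightarrow> (f has_field_derivative f' s) (at s within {t0..T})"
    and f': "continuous_on {t0..T} f'"
    and \<theta>: "continuous_on {0..1} \<theta>" "\<And>w. w \<in> {0..1} \<Longrightarrow> \<theta> w \<in> {0..1}"
    and m: "continuous_on {0..1} m" and t: "t \<in> {t0<..<T}"
  shows "((\<lambda>t. integral {0..1} (\<lambda>w. m w * f (t0 + \<theta> w * (t - t0)))) has_field_derivative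
           integral {0..1} (\<lambda>w. m w * \<theta> w * f' (t0 + \<theta> w * (t - t0)))) (at t)"
proof -
  have mem: "t0 + \<theta> w * (s - t0) \<in> {t0..T}" if "w \<in> {0..1}" "s \<in> {t0<..<T}" for w s
  proof -
    have "0 \<le> \<theta> w * (s - t0)" "\<theta> w * (s - t0) \<le> 1 * (s - t0)"
      using \<theta>(2)[OF that(1)] that(2) by (auto intro: mult_right_mono simp del: mult_1)
    with that(2) show ?thesis
      unfolding atLeastAtMost_iff greaterThanLessThan_iff mult_1 by linarith
  qed
  have cont_f: "continuous_on {t0..T} f"
    using f by (rule DERIV_continuous_on)
  have "((\<lambda>t. integral (cbox 0 1) (\<lambda>w. m w * f (t0 + \<theta> w * (t - t0)))) has_field_derivative
           integral (cbox 0 1) (\<lambda>w. m w * \<theta> w * f' (t0 + \<theta> w * (t - t0)))) (at t within {t0<..<T})"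
  proof (rule leibniz_rule_field_derivative)
    fix s w :: real assume s: "s \<in> {t0<..<T}" and w: "w \<in> cbox 0 1"
    have "(f \<circ> (\<lambda>s. t0 + \<theta> w * (s - t0)) has_field_derivative
             f' (t0 + \<theta> w * (s - t0)) * \<theta> w) (at s within {t0<..<T})"
    \<comment> \<open>Where \<open>\<theta> w = 0\<close> the argument of \<open>f\<close> is the
      endpoint t0, at which \<open>f\<close> has only a one-sided derivative; hence the chain rule
      relative to the image.\<close>
    proof (rule DERIV_image_chain)
      show "(f has_field_derivative f' (t0 + \<theta> w * (s - t0)))
              (at (t0 + \<theta> w * (s - t0)) within (\<lambda>s. t0 + \<theta> w * (s - t0)) ` {t0<..<T})"
        using mem w s by (intro DERIV_subset[OF f]) auto
    qed (auto intro!: derivative_eq_intros)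
    then show "((\<lambda>s. m w * f (t0 + \<theta> w * (s - t0))) has_field_derivative
             m w * \<theta> w * f' (t0 + \<theta> w * (s - t0))) (at s within {t0<..<T})"
      by (auto intro!: derivative_eq_intros simp: o_def)
  next
    fix s assume s: "s \<in> {t0<..<T}"
    have "continuous_on {0..1} (\<lambda>w. m w * f (t0 + \<theta> w * (s - t0)))"
      using mem s by (intro continuous_intros m \<theta>(1) continuous_on_compose2[OF cont_f]) auto
    then show "(\<lambda>w. m w * f (t0 + \<theta> w * (s - t0))) integrable_on cbox 0 1"
      by (simp add: integrable_continuous_real)
  next
    show "continuous_on ({t0<..<T} \<times> cbox 0 1) (\<lambda>(s, w). m w * \<theta> w * f' (t0 + \<theta> w * (s - t0)))"
      unfolding split_beta using mem
      by (intro continuous_intros continuous_on_compose2[OF m] continuous_on_compose2[OF \<theta>(1)]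
          continuous_on_compose2[OF f']) auto
  qed (use t in auto)
  then show ?thesis
    using t by (simp add: at_within_open[of t "{t0<..<T}"])
qed

text \<open>After the substitution the integral is a constant times (t - t0)^\<beta> times
  \<open>H 0\<close>, where \<open>H k\<close> is the k-th derivative of \<open>H 0\<close>. The
  power is in general not smooth at t0, whence the open interval.\<close>

lemma ntimes_differentiable_RL_int:
  assumes \<beta>: "0 < \<beta>"
    and f: "\<And>n s. s \<in> {t0..T} \<Longrightarrow> (f n has_field_derivative f (Suc n) s) (at s within {t0..T})"
  shows "ntimes_differentiable n {t0<..<T} (RL_int t0 \<beta> (f 0))"
proof -
  define \<theta> where "\<theta> w = 1 - w powr (1 / \<beta>)" for w
  have cont_\<theta>: "continuous_on {0..1} \<theta>"
    unfolding \<theta>_def using \<beta> by (intro continuous_intros continuous_on_powr') auto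
  have \<theta>_mem: "\<theta> w \<in> {0..1}" if "w \<in> {0..1}" for w
    using that \<beta> by (auto simp: \<theta>_def intro!: powr_le1)
  have cont_f: "continuous_on {t0..T} (f k)" for k
    using f by (rule DERIV_continuous_on)
  define H where "H k t = integral {0..1} (\<lambda>w. \<theta> w ^ k * f k (t0 + \<theta> w * (t - t0)))" for k t
  have "(H k has_field_derivative H (Suc k) t) (at t)" if "t \<in> {t0<..<T}" for k t
    \<comment> \<open>Splits the new factor off on the right, so that \<theta>^k takes the place of
      the weight \<open>m\<close>.\<close>
    unfolding H_def power_Suc2
    by (rule has_field_derivative_integral_rescaled[OF f cont_f cont_\<theta> \<theta>_mem _ that])
      (auto intro!: continuous_intros cont_\<theta>)
  then have "ntimes_differentiable n {t0<..<T} (H 0)"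
    by (rule ntimes_differentiable_family)
  moreover have "ntimes_differentiable n {t0<..<T} (\<lambda>t. (t - t0) powr \<beta>)"
    by (rule ntimes_differentiable_subset[OF ntimes_differentiable_powr]) auto
  ultimately have
    "ntimes_differentiable n {t0<..<T} (\<lambda>t. 1 / (\<beta> * Gamma \<beta>) * (t - t0) powr \<beta> * H 0 t)"
    by (intro ntimes_differentiable_mult ntimes_differentiable_const)
  then show ?thesis
  proof (rule ntimes_differentiable_cong[rotated])
    fix t assume "t \<in> {t0<..<T}"
    then show "1 / (\<beta> * Gamma \<beta>) * (t - t0) powr \<beta> * H 0 t = RL_int t0 \<beta> (f 0) t"
      using RL_int_substitution(2)[OF \<beta>, of t0 t "f 0"] continuous_on_subset[OF cont_f[of 0]]
      by (simp add: H_def \<theta>_def)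
  qed simp
qed

text \<open>The family \<open>v\<close> agrees with \<open>u\<close> only on the closed rectangle,
  so differentiability is shown for \<open>v\<close> and carried over to \<open>u\<close> on open
  intervals.\<close>

lemma smooth_data_imp_regular_at:
  assumes \<alpha>: "\<alpha> < real p" and u: "smooth_data a b t0 T K u"
    and x: "x \<in> {a<..<b}" and t: "t \<in> {t0<..<T}"
  shows "regular_at t0 p \<alpha> K u x t"
proof -
  define \<beta> where "\<beta> = real p - \<alpha>"
  have \<beta>: "0 < \<beta>"
    using \<alpha> by (simp add: \<beta>_def)
  obtain v where v0: "\<And>x t. x \<in> {a..b} \<Longrightarrow> t \<in> {t0..T} \<Longrightarrow> v 0 0 x t = u x t"
    and vx: "\<And>m n x t. x \<in> {a..b} \<Longrightarrow> t \<in> {t0..T} \<Longrightarrow>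
      ((\<lambda>y. v m n y t) has_field_derivative v (Suc m) n x t) (at x within {a..b})"
    and vt: "\<And>m n x t. x \<in> {a..b} \<Longrightarrow> t \<in> {t0..T} \<Longrightarrow>
      ((\<lambda>s. v m n x s) has_field_derivative v m (Suc n) x t) (at t within {t0..T})"
    using u unfolding smooth_data_def smooth_field_def by metis
  obtain S where S: "open S" "\<And>x t. x \<in> {a..b} \<Longrightarrow> t \<in> {t0..T} \<Longrightarrow> u x t \<in> S"
    and K: "\<And>n y. y \<in> S \<Longrightarrow> (deriv ^^ n) K field_differentiable (at y)"
    using u unfolding smooth_data_def by blast
  have "ntimes_differentiable 2 S ((deriv ^^ 0) K)"
    by (rule ntimes_differentiable_family) (use K in \<open>auto dest: field_differentiable_derivI\<close>)
  moreover have "ntimes_differentiable 2 {a<..<b} (\<lambda>y. v 0 0 y t)"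
  proof (rule ntimes_differentiable_family[where f = "\<lambda>m y. v m 0 y t"])
    fix k y assume "y \<in> {a<..<b}"
    then show "((\<lambda>y. v k 0 y t) has_field_derivative v (Suc k) 0 y t) (at y)"
      using vx[of y t k 0] t by (simp add: at_within_Icc_at)
  qed
  moreover have "(\<lambda>y. v 0 0 y t) ` {a<..<b} \<subseteq> S"
    using S(2) v0 t by auto
  ultimately have "ntimes_differentiable 2 {a<..<b} (\<lambda>y. K (v 0 0 y t))"
    using ntimes_differentiable_compose[of 2 S K] by simp
  then have "ntimes_differentiable 2 {a<..<b} (\<lambda>y. K (u y t))"
    by (rule ntimes_differentiable_cong[rotated]) (use v0 t in auto)
  then have reg_x: "times_differentiable_near 2 (\<lambda>y. K (u y t)) x"
    using x by (intro ntimes_differentiable_imp_near) auto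
  have cont_u: "continuous_on {t0..T} (u x)"
  proof -
    have "continuous_on {t0..T} (v 0 0 x)"
      using vt[of x _ 0 0] x by (intro DERIV_continuous_on) auto
    then show ?thesis
      by (rule continuous_on_cong[THEN iffD1, rotated -1]) (use v0 x in auto)
  qed
  have "\<forall>s\<in>{t0<..<T}. set_integrable lborel {t0..s} (\<lambda>\<tau>. u x \<tau> / (s - \<tau>) powr (1 - \<beta>))"
    using continuous_on_subset[OF cont_u] by (auto intro!: RL_int_substitution(1)[OF \<beta>])
  then have reg_int:
    "\<forall>\<^sub>F s in nhds t. set_integrable lborel {t0..s} (\<lambda>\<tau>. u x \<tau> / (s - \<tau>) powr (1 - \<beta>))"
    using t by (auto simp: eventually_nhds intro!: exI[of _ "{t0<..<T}"])
  have RL_v: "RL_int t0 \<beta> (v 0 0 x) s = RL_int t0 \<beta> (u x) s" if "s \<in> {t0<..<T}" for s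
    unfolding RL_int_def using that v0[of x] x
    by (intro arg_cong2[of _ _ _ _ "(*)"] set_lebesgue_integral_cong refl) auto
  have "ntimes_differentiable p {t0<..<T} (RL_int t0 \<beta> (u x))"
  proof (rule ntimes_differentiable_cong[rotated])
    show "ntimes_differentiable p {t0<..<T} (RL_int t0 \<beta> (v 0 0 x))"
      using vt x by (intro ntimes_differentiable_RL_int[OF \<beta>, where f = "\<lambda>n. v 0 n x"]) simp
  qed (use RL_v in simp_all)
  then have "times_differentiable_near p (RL_int t0 \<beta> (u x)) t"
    using t by (intro ntimes_differentiable_imp_near) auto
  with reg_x reg_int show ?thesis
    by (simp add: regular_at_def \<beta>_def)
qed

subsection \<open>Discrete conservation laws\<close>

lemma dt_pos:
  "grid_on a b t0 T g \<Longrightarrow> j < n_t g \<Longrightarrow> 0 < dt g j"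
  by (simp add: grid_on_def dt_def)

lemma dx_pos:
  "grid_on a b t0 T g \<Longrightarrow> a < b \<Longrightarrow> 0 < dx g"
  by (simp add: grid_on_def dx_def)

lemma t_node_strict_mono:
  assumes "grid_on a b t0 T g" and "i < j" and "j \<le> n_t g"
  shows "t_node g i < t_node g j"
  using assms(2,3)
proof (induction j)
  case (Suc j)
  then have "t_node g j < t_node g (Suc j)"
    using assms(1) by (simp add: grid_on_def)
  with Suc show ?case
    by (cases "i = j") auto
qed simp

lemma t_node_mem:
  assumes "grid_on a b t0 T g" and "j < n_t g"
  shows "t_node g j \<in> {t0..<T}" and "1 \<le> j \<Longrightarrow> t_node g j \<in> {t0<..<T}"
  using assms t_node_strict_mono[OF assms(1), of 0 j] t_node_strict_mono[OF assms(1), of j "n_t g"]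
  by (cases j; simp add: grid_on_def)+

lemma x_node_mem:
  assumes "grid_on a b t0 T g" and "a < b" and "i \<in> {1..n_x g}"
  shows "x_node g i \<in> {a<..<b}"
proof -
  have "real i * dx g < (real (n_x g) + 1) * dx g" "0 < real i * dx g"
    using assms(3) dx_pos[OF assms(1,2)] by auto
  moreover have "(real (n_x g) + 1) * dx g = b - a" "x_left g = a"
    using assms(1) by (simp_all add: dx_def grid_on_def)
  ultimately show ?thesis
    by (simp add: x_node_def)
qed

text \<open>Consecutive sums differ by the single term r = j, whose step \<open>dt g j\<close>
  cancels against the divisor.\<close>

lemma D_dt_dG1:
  "dt g j \<noteq> 0 \<Longrightarrow> D_dt g (dG1 \<D> g u) i j = \<D> g u i j"
  by (simp add: D_dt_def dG1_def)

text \<open>Summation by parts: the difference of t_j G1_j is t_j (G1_(j+1) - G1_j) plus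
  \<open>dt g j\<close> times G1_(j+1), and the latter is exactly the term that the subtracted sum
  gains from j to j + 1.\<close>

lemma D_dt_dG3:
  assumes "dt g j \<noteq> 0"
  shows "D_dt g (dG3 \<D> g u) i j = t_node g j * \<D> g u i j"
proof -
  have "dG3 \<D> g u i (j + 1) - dG3 \<D> g u i j
      = t_node g j * (dG1 \<D> g u i (j + 1) - dG1 \<D> g u i j)"
    by (simp add: dG3_def dt_def algebra_simps)
  then have "D_dt g (dG3 \<D> g u) i j = t_node g j * D_dt g (dG1 \<D> g u) i j"
    by (simp add: D_dt_def)
  with D_dt_dG1[OF assms] show ?thesis
    by simp
qed

lemma D_dt_x_node_mult:
  "D_dt g (\<lambda>i j. x_node g i * f i j) i j = x_node g i * D_dt g f i j"
  by (simp add: D_dt_def algebra_simps diff_divide_distrib)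

lemma D_dx_time_mult:
  "D_dx g (\<lambda>i j. \<rho> j * f i j) i j = \<rho> j * D_dx g f i j"
  by (simp add: D_dx_def algebra_simps diff_divide_distrib)

text \<open>A forward difference of backward differences is the centred second difference;
  \<open>1 \<le> i\<close> makes \<open>i - 1\<close> the true left neighbour.\<close>

lemma D_dx_dF1:
  "1 \<le> i \<Longrightarrow> D_dx g (dF1 K g u) i j = - D2_dx g (Kmesh K u) i j"
  by (simp add: D_dx_def dF1_def D2_dx_def power2_eq_square diff_divide_distrib add_divide_distrib)

text \<open>Discrete form of (K - x K')' = - x K''. Uniform spacing gives x_(i+1) + x_(i-1) = 2 x_i,
  the coefficient of the middle value.\<close>

lemma D_dx_dF2:
  assumes "1 \<le> i"
  shows "D_dx g (dF2 K g u) i j = - x_node g i * D2_dx g (Kmesh K u) i j"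
proof -
  have x: "x_node g (i + 1) = x_node g i + dx g" "x_node g (i - 1) = x_node g i - dx g"
    using assms by (simp_all add: x_node_def of_nat_diff algebra_simps)
  have "dF2 K g u (i + 1) j - dF2 K g u i j
      = 1 / dx g * (x_node g (i + 1) * K (u i j) - x_node g i * K (u (i + 1) j)
          - (x_node g i * K (u (i - 1) j) - x_node g (i - 1) * K (u i j)))"
    by (simp add: dF2_def right_diff_distrib)
  also have "\<dots> = 1 / dx g * (- x_node g i * (K (u (i + 1) j) - 2 * K (u i j) + K (u (i - 1) j)))"
    unfolding x by (simp add: algebra_simps)
  finally show ?thesis
    by (simp add: D_dx_def D2_dx_def Kmesh_def power2_eq_square)
qed

text \<open>Stated for arbitrary mesh functions, since accuracy concerns sampled fields that do not
  solve the scheme; for solutions the residual vanishes.\<close>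

lemma disc_div_laws:
  assumes "dt g j \<noteq> 0" and "1 \<le> i"
  shows "disc_div g (dF1 K g u) (dG1 \<D> g u) i j = scheme_residual K \<D> g u i j"
    and "disc_div g (dF2 K g u) (dG2 \<D> g u) i j = x_node g i * scheme_residual K \<D> g u i j"
    and "disc_div g (dF3 K g u) (dG3 \<D> g u) i j = t_node g j * scheme_residual K \<D> g u i j"
    and "disc_div g (dF4 K g u) (dG4 \<D> g u) i j
           = x_node g i * t_node g j * scheme_residual K \<D> g u i j"
proof -
  have "dG2 \<D> g u = (\<lambda>i j. x_node g i * dG1 \<D> g u i j)"
    "dG4 \<D> g u = (\<lambda>i j. x_node g i * dG3 \<D> g u i j)"
    "dF3 K g u = (\<lambda>i j. t_node g j * dF1 K g u i j)"
    "dF4 K g u = (\<lambda>i j. t_node g j * dF2 K g u i j)"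
    by (simp_all add: fun_eq_iff dG2_def dG4_def dF3_def dF4_def)
  with assms show "disc_div g (dF1 K g u) (dG1 \<D> g u) i j = scheme_residual K \<D> g u i j"
    "disc_div g (dF2 K g u) (dG2 \<D> g u) i j = x_node g i * scheme_residual K \<D> g u i j"
    "disc_div g (dF3 K g u) (dG3 \<D> g u) i j = t_node g j * scheme_residual K \<D> g u i j"
    "disc_div g (dF4 K g u) (dG4 \<D> g u) i j
       = x_node g i * t_node g j * scheme_residual K \<D> g u i j"
    by (simp_all add: disc_div_def scheme_residual_def D_dt_x_node_mult D_dx_time_mult
        D_dt_dG1 D_dt_dG3 D_dx_dF1 D_dx_dF2 algebra_simps)
qed

text \<open>Inserting x_i = x_(i-1) + dx, both sides become K_(i-1) - x_(i-1) (K_i - K_(i-1)) /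
  dx.\<close>

lemma dF2_eq_average:
  assumes "1 \<le> i" and "dx g \<noteq> 0"
  shows "dF2 K g u i j = A_dx (Kmesh K u) (i - 1) j
           - A_dx (\<lambda>i j. x_node g i) (i - 1) j * D_dx g (Kmesh K u) (i - 1) j"
proof -
  have "x_node g i = x_node g (i - 1) + dx g"
    using assms(1) by (simp add: x_node_def of_nat_diff algebra_simps)
  with assms show ?thesis
    by (simp add: dF2_def A_dx_def D_dx_def Kmesh_def field_simps)
qed


subsection \<open>Continuous conservation laws\<close>

lemma times_differentiable_near_has_deriv:
  assumes "times_differentiable_near n f x" and "m < n"
  shows "((deriv ^^ m) f has_field_derivative (deriv ^^ Suc m) f x) (at x)"
proof -
  have "(deriv ^^ m) f field_differentiable (at x)"
    using assms by (auto simp: times_differentiable_near_def dest: eventually_nhds_x_imp_x)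
  then show ?thesis
    by (simp add: field_differentiable_derivI)
qed

lemma div_eqI:
  assumes "((\<lambda>y. F y t) has_field_derivative Fx) (at x)"
    and "((\<lambda>s. G x s) has_field_derivative Gt) (at t)"
  shows "div_exists_at F G x t \<and> cont_div F G x t = Fx + Gt"
  using assms by (auto simp: div_exists_at_def cont_div_def field_differentiable_def DERIV_imp_deriv)

lemma regular_at_derivs_x:
  assumes "regular_at t0 p \<alpha> K u x t"
  shows "((\<lambda>y. K (u y t)) has_field_derivative deriv (\<lambda>y. K (u y t)) x) (at x)"
    and "((\<lambda>y. deriv (\<lambda>y. K (u y t)) y) has_field_derivative (deriv ^^ 2) (\<lambda>y. K (u y t)) x) (at x)"
  using assms times_differentiable_near_has_deriv[of 2 "\<lambda>y. K (u y t)" x 0]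
    times_differentiable_near_has_deriv[of 2 "\<lambda>y. K (u y t)" x 1]
  by (simp_all add: regular_at_def numeral_2_eq_2)

text \<open>\<open>G1\<close> is the derivative of order p - 1 of the fractional integral;
  \<open>1 \<le> p\<close> ensures that one more differentiation gives order p despite truncated
  subtraction.\<close>

lemma regular_at_deriv_G1:
  assumes "regular_at t0 p \<alpha> K u x t" and "1 \<le> p"
  shows "((\<lambda>s. G1 t0 p \<alpha> u x s) has_field_derivative RL_deriv t0 p \<alpha> (u x) t) (at t)"
  using assms times_differentiable_near_has_deriv[of p "RL_int t0 (real p - \<alpha>) (u x)" t "p - 1"]
  by (simp add: regular_at_def RL_deriv_def G1_def)

text \<open>Since 1 - (\<alpha> - 1) = 2 - \<alpha>, both terms of \<open>G3\<close> come from the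
  same integral I, and (t I' - I)' = t I''.\<close>

lemma regular_at_deriv_G3:
  assumes "regular_at t0 2 \<alpha> K u x t"
  shows "((\<lambda>s. G3 t0 \<alpha> u x s) has_field_derivative t * RL_deriv t0 2 \<alpha> (u x) t) (at t)"
proof -
  let ?I = "RL_int t0 (2 - \<alpha>) (u x)"
  have "(?I has_field_derivative deriv ?I t) (at t)"
    "(deriv ?I has_field_derivative RL_deriv t0 2 \<alpha> (u x) t) (at t)"
    using assms times_differentiable_near_has_deriv[of 2 ?I t 0]
      times_differentiable_near_has_deriv[of 2 ?I t 1]
    by (simp_all add: regular_at_def RL_deriv_def numeral_2_eq_2)
  then show ?thesis
    unfolding G3_def RL_deriv_def by (auto intro!: derivative_eq_intros)
qed

lemma cont_div_laws12:
  assumes "regular_at t0 p \<alpha> K u x t" and "1 \<le> p"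
  shows "div_exists_at (F1 K u) (G1 t0 p \<alpha> u) x t \<and>
      cont_div (F1 K u) (G1 t0 p \<alpha> u) x t = pde_residual t0 p \<alpha> K u x t"
    and "div_exists_at (F2 K u) (G2 t0 p \<alpha> u) x t \<and>
      cont_div (F2 K u) (G2 t0 p \<alpha> u) x t = x * pde_residual t0 p \<alpha> K u x t"
proof -
  note derivs = regular_at_derivs_x[OF assms(1)] regular_at_deriv_G1[OF assms]
  have F1: "((\<lambda>y. F1 K u y t) has_field_derivative - (deriv ^^ 2) (\<lambda>y. K (u y t)) x) (at x)"
    unfolding F1_def by (intro DERIV_minus derivs)
  have F2: "((\<lambda>y. F2 K u y t) has_field_derivative - x * (deriv ^^ 2) (\<lambda>y. K (u y t)) x) (at x)"
    unfolding F2_def by (rule derivative_eq_intros derivs refl)+ simp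
  have G2: "((\<lambda>s. G2 t0 p \<alpha> u x s) has_field_derivative x * RL_deriv t0 p \<alpha> (u x) t) (at t)"
    unfolding G2_def by (intro DERIV_cmult derivs)
  show "div_exists_at (F1 K u) (G1 t0 p \<alpha> u) x t \<and>
      cont_div (F1 K u) (G1 t0 p \<alpha> u) x t = pde_residual t0 p \<alpha> K u x t"
    using div_eqI[of "F1 K u" t _ x "G1 t0 p \<alpha> u", OF F1 derivs(3)] by (simp add: pde_residual_def)
  show "div_exists_at (F2 K u) (G2 t0 p \<alpha> u) x t \<and>
      cont_div (F2 K u) (G2 t0 p \<alpha> u) x t = x * pde_residual t0 p \<alpha> K u x t"
    using div_eqI[of "F2 K u" t _ x "G2 t0 p \<alpha> u", OF F2 G2] by (simp add: pde_residual_def right_diff_distrib)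
qed

lemma cont_div_laws34:
  assumes "regular_at t0 2 \<alpha> K u x t"
  shows "div_exists_at (F3 K u) (G3 t0 \<alpha> u) x t \<and>
      cont_div (F3 K u) (G3 t0 \<alpha> u) x t = t * pde_residual t0 2 \<alpha> K u x t"
    and "div_exists_at (F4 K u) (G4 t0 \<alpha> u) x t \<and>
      cont_div (F4 K u) (G4 t0 \<alpha> u) x t = x * t * pde_residual t0 2 \<alpha> K u x t"
proof -
  note derivs = regular_at_derivs_x[OF assms] regular_at_deriv_G3[OF assms]
  have F3: "((\<lambda>y. F3 K u y t) has_field_derivative - t * (deriv ^^ 2) (\<lambda>y. K (u y t)) x) (at x)"
    unfolding F3_def by (intro DERIV_cmult derivs)
  have F4: "((\<lambda>y. F4 K u y t) has_field_derivative - x * t * (deriv ^^ 2) (\<lambda>y. K (u y t)) x) (at x)"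
    unfolding F4_def by (rule derivative_eq_intros derivs refl)+ simp
  have "G4 t0 \<alpha> u x = (\<lambda>s. x * G3 t0 \<alpha> u x s)"
    by (simp add: fun_eq_iff G3_def G4_def algebra_simps)
  then have G4: "((\<lambda>s. G4 t0 \<alpha> u x s) has_field_derivative x * (t * RL_deriv t0 2 \<alpha> (u x) t)) (at t)"
    by (simp add: DERIV_cmult derivs)
  show "div_exists_at (F3 K u) (G3 t0 \<alpha> u) x t \<and>
      cont_div (F3 K u) (G3 t0 \<alpha> u) x t = t * pde_residual t0 2 \<alpha> K u x t"
    using div_eqI[of "F3 K u" t _ x "G3 t0 \<alpha> u", OF F3 derivs(3)] by (simp add: pde_residual_def right_diff_distrib)
  show "div_exists_at (F4 K u) (G4 t0 \<alpha> u) x t \<and>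
      cont_div (F4 K u) (G4 t0 \<alpha> u) x t = x * t * pde_residual t0 2 \<alpha> K u x t"
    using div_eqI[of "F4 K u" t _ x "G4 t0 \<alpha> u", OF F4 G4] by (simp add: pde_residual_def right_diff_distrib)
qed


subsection \<open>Accuracy\<close>

text \<open>Reduces each accuracy claim to two exact identities, so that no Taylor expansion or
  consistency of the integrator enters.\<close>

lemma same_accuracyI:
  fixes k :: nat and \<rho> :: "real \<Rightarrow> real"
  assumes \<alpha>: "\<alpha> < real p" and ab: "a < b"
    and \<rho>: "continuous_on {t0..T} \<rho>"
    and disc: "\<And>g u i j. grid_on a b t0 T g \<Longrightarrow> i \<in> {1..n_x g} \<Longrightarrow> j < n_t g \<Longrightarrow>
      disc_div g (dF g u) (dG g u) i j
        = x_node g i ^ k * \<rho> (t_node g j) * scheme_residual K \<D> g u i j"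
    and cont: "\<And>u x t. regular_at t0 p \<alpha> K u x t \<Longrightarrow>
      div_exists_at (F u) (G u) x t \<and>
      cont_div (F u) (G u) x t = x ^ k * \<rho> t * pde_residual t0 p \<alpha> K u x t"
  shows "same_accuracy a b t0 T p \<alpha> K \<D> k \<rho> dF dG F G"
proof -
  have "continuous_on ({a..b} \<times> {t0..T}) (\<lambda>z. fst z ^ k * \<rho> (snd z))"
    by (intro continuous_intros continuous_on_compose2[OF \<rho>]) auto
  then have "bounded ((\<lambda>z. fst z ^ k * \<rho> (snd z)) ` ({a..b} \<times> {t0..T}))"
    by (intro compact_imp_bounded compact_continuous_image compact_Times) auto
  then obtain B where B: "\<And>x t. x \<in> {a..b} \<Longrightarrow> t \<in> {t0..T} \<Longrightarrow> \<bar>x ^ k * \<rho> t\<bar> \<le> B"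
    by (force simp: bounded_iff)
  have order: "(\<lambda>n. law_error dF dG F G u (g n) (i n) (j n))
          \<in> O(\<lambda>n. method_error t0 p \<alpha> K \<D> u (g n) (i n) (j n)) \<and>
        ((\<exists>c>0. \<forall>n. c \<le> \<bar>x_node (g n) (i n) ^ k * \<rho> (t_node (g n) (j n))\<bar>) \<longrightarrow>
          (\<lambda>n. law_error dF dG F G u (g n) (i n) (j n))
            \<in> \<Theta>(\<lambda>n. method_error t0 p \<alpha> K \<D> u (g n) (i n) (j n)))"
    if u: "smooth_data a b t0 T K u"
      and g: "\<And>n. grid_on a b t0 T (g n) \<and> i n \<in> {1..n_x (g n)} \<and> j n < n_t (g n) \<and>
             (j n \<ge> 1 \<or> regular_at t0 p \<alpha> K u (x_node (g n) (i n)) t0)"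
    for u and g :: "nat \<Rightarrow> grid" and i j
  proof -
    define \<mu> where "\<mu> n = x_node (g n) (i n) ^ k * \<rho> (t_node (g n) (j n))" for n
    let ?L = "\<lambda>n. law_error dF dG F G u (g n) (i n) (j n)"
    let ?M = "\<lambda>n. method_error t0 p \<alpha> K \<D> u (g n) (i n) (j n)"
    have x: "x_node (g n) (i n) \<in> {a<..<b}" for n
      using x_node_mem g ab by blast
    \<comment> \<open>Nodes with j \<ge> 1 lie strictly after t0, where smoothness suffices; at j =
      0 regularity is part of the hypothesis \<open>g\<close>.\<close>
    have "regular_at t0 p \<alpha> K u (x_node (g n) (i n)) (t_node (g n) (j n))" for n
    proof (cases "1 \<le> j n")
      case True
      with g t_node_mem(2) have "t_node (g n) (j n) \<in> {t0<..<T}"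
        by blast
      then show ?thesis
        by (rule smooth_data_imp_regular_at[OF \<alpha> u x])
    next
      case False
      then have "j n = 0"
        by simp
      with g[of n] show ?thesis
        by (simp add: grid_on_def)
    qed
    then have "?L n = \<mu> n * ?M n" for n
      using disc g cont by (simp add: law_error_def method_error_def \<mu>_def right_diff_distrib)
    then have L: "norm (?L n) = \<bar>\<mu> n\<bar> * norm (?M n)" for n
      by (simp add: abs_mult)
    have "\<bar>\<mu> n\<bar> \<le> B" for n
      unfolding \<mu>_def using x[of n] t_node_mem(1)[of a b t0 T "g n" "j n"] g[of n]
      by (intro B) auto
    then have bigO: "?L \<in> O(?M)"
      by (intro bigoI[of _ B] always_eventually allI) (simp only: L mult_right_mono norm_ge_zero)
    \<comment> \<open>The lower bound c on the multiplier serves as the constant of the reverse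
      estimate.\<close>
    have "?L \<in> \<Theta>(?M)" if "c > 0" "\<forall>n. c \<le> \<bar>\<mu> n\<bar>" for c
      using that bigO by (intro bigthetaI landau_omega.bigI[of c] always_eventually allI)
        (simp_all only: L mult_right_mono norm_ge_zero)
    with bigO show ?thesis
      unfolding \<mu>_def by blast
  qed
  show ?thesis
    unfolding same_accuracy_def using disc cont order by blast
qed

theorem mainTheorem4:
  fixes p :: nat and \<alpha> a b t0 T :: real and K :: "real \<Rightarrow> real" and \<D> :: integrator
  assumes "1 \<le> p" and "real p - 1 < \<alpha>" and "\<alpha> < real p" and "a < b" and "t0 < T"
  shows
   "((\<forall>g u. grid_on a b t0 T g \<and> method_solution K \<D> g u \<longrightarrow>
        disc_conservation_law g (dF1 K g u) (dG1 \<D> g u) \<and>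
        disc_conservation_law g (dF2 K g u) (dG2 \<D> g u)) \<and>
     (\<forall>g u. \<forall>i\<in>{1..n_x g + 1}. \<forall>j\<le>n_t g. grid_on a b t0 T g \<longrightarrow>
        dF2 K g u i j =
          A_dx (Kmesh K u) (i - 1) j
          - A_dx (\<lambda>i j. x_node g i) (i - 1) j * D_dx g (Kmesh K u) (i - 1) j) \<and>
     (\<forall>u. pde_solution a b t0 T p \<alpha> K u \<longrightarrow>
        conservation_law a b t0 T (F1 K u) (G1 t0 p \<alpha> u) \<and>
        conservation_law a b t0 T (F2 K u) (G2 t0 p \<alpha> u)) \<and>
     same_accuracy a b t0 T p \<alpha> K \<D> 0 (\<lambda>t. 1) (dF1 K) (dG1 \<D>) (F1 K) (G1 t0 p \<alpha>) \<and>
     same_accuracy a b t0 T p \<alpha> K \<D> 1 (\<lambda>t. 1) (dF2 K) (dG2 \<D>) (F2 K) (G2 t0 p \<alpha>))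
    \<and>
    (p = 2 \<longrightarrow>
     (\<forall>g u. grid_on a b t0 T g \<and> method_solution K \<D> g u \<longrightarrow>
        disc_conservation_law g (dF3 K g u) (dG3 \<D> g u) \<and>
        disc_conservation_law g (dF4 K g u) (dG4 \<D> g u)) \<and>
     (\<forall>g u. \<forall>i\<in>{1..n_x g + 1}. \<forall>j\<le>n_t g. grid_on a b t0 T g \<longrightarrow>
        dF3 K g u i j = - t_node g j * D_dx g (Kmesh K u) (i - 1) j) \<and>
     (\<forall>u. pde_solution a b t0 T p \<alpha> K u \<longrightarrow>
        conservation_law a b t0 T (F3 K u) (G3 t0 \<alpha> u) \<and>
        conservation_law a b t0 T (F4 K u) (G4 t0 \<alpha> u)) \<and>
     same_accuracy a b t0 T p \<alpha> K \<D> 0 (\<lambda>t. t) (dF3 K) (dG3 \<D>) (F3 K) (G3 t0 \<alpha>) \<and>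
     same_accuracy a b t0 T p \<alpha> K \<D> 1 (\<lambda>t. t) (dF4 K) (dG4 \<D>) (F4 K) (G4 t0 \<alpha>))"
proof (intro conjI impI; (elim conjE)?)
  have dt: "dt g j \<noteq> 0" if "grid_on a b t0 T g" "j < n_t g" for g j
    using dt_pos[OF that] by simp
  have dx: "dx g \<noteq> 0" if "grid_on a b t0 T g" for g
    using dx_pos[OF that \<open>a < b\<close>] by simp
  note disc = disc_conservation_law_def method_solution_def disc_div_laws dt
  note cont = conservation_law_def pde_solution_def
  show "\<forall>g u. grid_on a b t0 T g \<and> method_solution K \<D> g u \<longrightarrow>
        disc_conservation_law g (dF1 K g u) (dG1 \<D> g u) \<and>
        disc_conservation_law g (dF2 K g u) (dG2 \<D> g u)"
    by (simp add: disc)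
  show "\<forall>g u. \<forall>i\<in>{1..n_x g + 1}. \<forall>j\<le>n_t g. grid_on a b t0 T g \<longrightarrow>
        dF2 K g u i j =
          A_dx (Kmesh K u) (i - 1) j
          - A_dx (\<lambda>i j. x_node g i) (i - 1) j * D_dx g (Kmesh K u) (i - 1) j"
    using dF2_eq_average dx by auto
  show "\<forall>u. pde_solution a b t0 T p \<alpha> K u \<longrightarrow>
        conservation_law a b t0 T (F1 K u) (G1 t0 p \<alpha> u) \<and>
        conservation_law a b t0 T (F2 K u) (G2 t0 p \<alpha> u)"
    using cont_div_laws12[OF _ \<open>1 \<le> p\<close>] by (simp add: cont)
  show "same_accuracy a b t0 T p \<alpha> K \<D> 0 (\<lambda>t. 1) (dF1 K) (dG1 \<D>) (F1 K) (G1 t0 p \<alpha>)"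
    by (rule same_accuracyI) (use assms dt cont_div_laws12 in \<open>simp_all add: disc_div_laws\<close>)
  show "same_accuracy a b t0 T p \<alpha> K \<D> 1 (\<lambda>t. 1) (dF2 K) (dG2 \<D>) (F2 K) (G2 t0 p \<alpha>)"
    by (rule same_accuracyI) (use assms dt cont_div_laws12 in \<open>simp_all add: disc_div_laws\<close>)
  \<comment> \<open>Here \<open>real p - \<alpha>\<close> becomes 2 - \<alpha>, the order of the
    integral in \<open>G3\<close> and \<open>G4\<close>.\<close>
  assume p: "p = 2"
  show "\<forall>g u. grid_on a b t0 T g \<and> method_solution K \<D> g u \<longrightarrow>
        disc_conservation_law g (dF3 K g u) (dG3 \<D> g u) \<and>
        disc_conservation_law g (dF4 K g u) (dG4 \<D> g u)"
    by (simp add: disc)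
  show "\<forall>g u. \<forall>i\<in>{1..n_x g + 1}. \<forall>j\<le>n_t g. grid_on a b t0 T g \<longrightarrow>
        dF3 K g u i j = - t_node g j * D_dx g (Kmesh K u) (i - 1) j"
    by (simp add: dF3_def dF1_def)
  show "\<forall>u. pde_solution a b t0 T p \<alpha> K u \<longrightarrow>
        conservation_law a b t0 T (F3 K u) (G3 t0 \<alpha> u) \<and>
        conservation_law a b t0 T (F4 K u) (G4 t0 \<alpha> u)"
    using cont_div_laws34 p by (simp add: cont)
  show "same_accuracy a b t0 T p \<alpha> K \<D> 0 (\<lambda>t. t) (dF3 K) (dG3 \<D>) (F3 K) (G3 t0 \<alpha>)"
    by (rule same_accuracyI) (use assms p dt cont_div_laws34 in \<open>simp_all add: disc_div_laws\<close>)
  show "same_accuracy a b t0 T p \<alpha> K \<D> 1 (\<lambda>t. t) (dF4 K) (dG4 \<D>) (F4 K) (G4 t0 \<alpha>)"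
    by (rule same_accuracyI) (use assms p dt cont_div_laws34 in \<open>simp_all add: disc_div_laws\<close>)
qed

end
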